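(* Let $n\ge 1$ and let $H(n)$ denote the number of convex hexagons in an $n$-triangular net. Then \[ H(n)=\begin{cases} \frac{1}{60}\left(8k^6+24k^5+25k^4+10k^3-3k^2-4k\right), & n=2k+1\ (k=0,1,2,\dots),\\[2pt] \frac{1}{60}\left(8k^6-5k^4-3k^2\right), & n=2k\ (k=1,2,\dots).\end{cases} \]
   Context: An $n$-triangular net ($n\ge 1$) is obtained from a triangle by dividing each of its three edges into $n$ equal parts and then, for each pair of edges, drawing the $n-1$ segments joining corresponding dividing points on those two edges parallel to the third edge. (For $n=1$ it is just the triangle.) The net thus consists of the three edges of the triangle together with these segments; all line segments of the net lie on lines parallel to one of the three sides. A convex hexagon in the net is a convex polygon with exactly six vertices (each interior angle strictly less than $\pi$) whose sides all lie on segments of the net (so its vertices are intersection points of the net). The count depends only on $n$, not on the shape or size of the triangle. *)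

theory Defs
  imports "HOL-Analysis.Analysis"
begin

definition division_point :: "nat \<Rightarrow> nat \<Rightarrow> real^2 \<Rightarrow> real^2 \<Rightarrow> real^2" where
  "division_point n i P Q = P + (real i / real n) *\<^sub>R (Q - P)"

text \<open>The segments cutting the two sides that meet at \<open>P\<close>; they are parallel to \<open>QR\<close>.\<close>

definition cross_segments :: "nat \<Rightarrow> real^2 \<Rightarrow> real^2 \<Rightarrow> real^2 \<Rightarrow> (real^2) set set" where
  "cross_segments n P Q R =
     {closed_segment (division_point n i P Q) (division_point n i P R) | i. 1 \<le> i \<and> i < n}"

definition triangular_net :: "nat \<Rightarrow> real^2 \<Rightarrow> real^2 \<Rightarrow> real^2 \<Rightarrow> (real^2) set set" where
  "triangular_net n A B C =
     {closed_segment A B, closed_segment B C, closed_segment C A}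
     \<union> cross_segments n A B C \<union> cross_segments n B C A \<union> cross_segments n C A B"

text \<open>A polygon is identified with the closed region it bounds. Its vertices are the extreme
  points of that region, so every interior angle is strictly less than \<open>\<pi>\<close>.\<close>

definition convex_hexagon :: "(real^2) set \<Rightarrow> bool" where
  "convex_hexagon P \<longleftrightarrow>
     polytope P \<and> aff_dim P = 2 \<and> card {v. v extreme_point_of P} = 6"

definition net_hexagons :: "nat \<Rightarrow> real^2 \<Rightarrow> real^2 \<Rightarrow> real^2 \<Rightarrow> (real^2) set set" where
  "net_hexagons n A B C =
     {P. convex_hexagon P \<and> (\<forall>e. e edge_of P \<longrightarrow> (\<exists>s \<in> triangular_net n A B C. e \<subseteq> s))}"

end

theory Submission
  imports Defs
begin

text \<open>In barycentric coordinates scaled so that \<open>x + y + z = n\<close>, the lines of the net are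
  \<open>x = i\<close>, \<open>y = i\<close>, \<open>z = i\<close> with \<open>0 \<le> i < n\<close>. A convex polygon has at most two sides in each of
  the three directions, so a hexagon in the net has exactly two in each and is given by
  \<open>a \<le> x \<le> a'\<close>, \<open>b \<le> y \<le> b'\<close>, \<open>c \<le> z \<le> c'\<close>. The six sides are nondegenerate precisely when every
  sum of one lower and two upper bounds exceeds \<open>n\<close> and every sum of one upper and two lower
  bounds is less than \<open>n\<close>. Such a hexagon is a triangle of size \<open>m\<close> with its three corners cut
  off, which turns the count into a threefold iterated sum.\<close>

section \<open>Counting the ways to cut three corners off a triangle\<close>

text \<open>The entries are the sizes of the triangles removed at the three corners of a triangle of
  size \<open>m\<close>. What remains of the side between the first two corners has length
  \<open>m - u - v\<close>, hence the strict inequalities.\<close>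

definition corner_cuts :: "nat \<Rightarrow> (nat \<times> nat \<times> nat) set" where
  "corner_cuts m = {(u, v, w). 0 < u \<and> 0 < v \<and> 0 < w \<and> u + v < m \<and> v + w < m \<and> u + w < m}"

lemma finite_corner_cuts: "finite (corner_cuts m)"
  by (rule finite_subset[of _ "{..m} \<times> {..m} \<times> {..m}"]) (auto simp: corner_cuts_def)

text \<open>The fibre over \<open>u\<close> has \<open>m - u\<close> elements. The factor 2 keeps
  the triangular number free of division in \<open>nat\<close>.\<close>

lemma card_pairs_sum_less: "2 * card {(u, v). u + v < (m::nat)} = m * (m + 1)"
proof -
  have "{(u, v). u + v < m} = (SIGMA u:{..<m}. {..<m - u})" by auto
  then have "card {(u, v). u + v < m} = (\<Sum>u<m. m - u)" by simp
  moreover have "2 * (\<Sum>u<m. m - u) = m * (m + 1)"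
  proof (induction m)
    case (Suc m)
    have "(\<Sum>u<Suc m. Suc m - u) = Suc m + (\<Sum>u<m. m - u)"
      by (subst sum.lessThan_Suc_shift) simp
    with Suc show ?case by (simp add: algebra_simps)
  qed simp
  ultimately show ?thesis by simp
qed

lemma finite_pairs_sum_less: "finite {(u, v). u + v < (m::nat)}"
  by (rule finite_subset[of _ "{..m} \<times> {..m}"]) auto

text \<open>Lowering all three cuts by one maps the triples for \<open>m + 3\<close> onto those for \<open>m + 1\<close>
  with zero entries allowed; the extra terms count the triples that contain a zero.\<close>

lemma card_corner_cuts_step:
  "2 * card (corner_cuts (m + 3)) = 2 * card (corner_cuts (m + 1)) + 3 * m * m + 3 * m + 2"
proof -
  let ?D = "\<lambda>k. {(u, v). u + v < (k::nat)}"
  \<comment> \<open>The images \<open>?A\<close>, \<open>?B\<close>, \<open>?C\<close> are sorted by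
    the position of the first entry equal to 1, which makes them disjoint; in \<open>?T\<close> all
    entries are at least 2. For \<open>m = 0\<close> the truncated \<open>m - 1\<close> is harmless,
    since \<open>?D 0\<close> is empty.\<close>
  let ?A = "(\<lambda>(v, w). (1::nat, v + 1, w + 1)) ` ?D (m + 1)"
  let ?B = "(\<lambda>(u, w). (u + 2, 1::nat, w + 1)) ` ?D m"
  let ?C = "(\<lambda>(u, v). (u + 2, v + 2, 1::nat)) ` ?D (m - 1)"
  let ?T = "(\<lambda>(u, v, w). (u + 1, v + 1, w + 1)) ` corner_cuts (m + 1)"
  have split: "corner_cuts (m + 3) = ?T \<union> (?A \<union> (?B \<union> ?C))" (is "?L = ?R")
  proof (intro subset_antisym subsetI)
    fix t assume t: "t \<in> ?L"
    obtain u v w where [simp]: "t = (Suc u, Suc v, Suc w)"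
      using t by (cases t) (auto simp: corner_cuts_def gr0_conv_Suc)
    have le: "u + v \<le> m" "v + w \<le> m" "u + w \<le> m"
      using t by (auto simp: corner_cuts_def)
    consider "u = 0" | "u > 0" "v = 0" | "u > 0" "v > 0" "w = 0" | "u > 0" "v > 0" "w > 0"
      by auto
    then show "t \<in> ?R"
    proof cases
      case 1 then have "t \<in> ?A" using le by (intro image_eqI[of _ _ "(v, w)"]) auto
      then show ?thesis by blast
    next
      case 2 then have "t \<in> ?B" using le by (intro image_eqI[of _ _ "(u - 1, w)"]) auto
      then show ?thesis by blast
    next
      case 3 then have "t \<in> ?C" using le by (intro image_eqI[of _ _ "(u - 1, v - 1)"]) auto
      then show ?thesis by blast
    next
      case 4 then have "t \<in> ?T"
        using le by (intro image_eqI[of _ _ "(u, v, w)"]) (auto simp: corner_cuts_def)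
      then show ?thesis by blast
    qed
  qed (auto simp: corner_cuts_def)
  have "card ?R = card ?T + (card ?A + (card ?B + card ?C))"
    by (subst card_Un_disjoint, (simp add: finite_corner_cuts finite_pairs_sum_less)+,
        force simp: corner_cuts_def)+ simp
  also have "card ?T = card (corner_cuts (m + 1))"
    by (rule card_image) (auto simp: inj_on_def)
  also have "card ?A = card (?D (m + 1))"
    by (rule card_image) (auto simp: inj_on_def)
  also have "card ?B = card (?D m)"
    by (rule card_image) (auto simp: inj_on_def)
  also have "card ?C = card (?D (m - 1))"
    by (rule card_image) (auto simp: inj_on_def)
  finally have "2 * card (corner_cuts (m + 3)) = 2 * card (corner_cuts (m + 1)) +
      (m + 1) * (m + 2) + m * (m + 1) + (m - 1) * (m - 1 + 1)"
    unfolding split using card_pairs_sum_less[of "m + 1"] card_pairs_sum_less[of m]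
      card_pairs_sum_less[of "m - 1"] by simp
  then show ?thesis by (cases m) (auto simp: algebra_simps)
qed

lemma corner_cuts_small: "m \<le> 2 \<Longrightarrow> corner_cuts m = {}"
  by (auto simp: corner_cuts_def)

text \<open>The recurrence advances the argument by two, so each parity has its own cubic; both
  start from an empty set.\<close>

lemma card_corner_cuts:
  "real (card (corner_cuts (2 * k + 1))) = 2 * real k ^ 3 - 3/2 * real k ^ 2 + 1/2 * real k"
  "real (card (corner_cuts (2 * k + 2))) = 2 * real k ^ 3 + 3/2 * real k ^ 2 + 1/2 * real k"
proof (induction k)
  case (Suc k)
  have step: "2 * real (card (corner_cuts (m + 3))) = 2 * real (card (corner_cuts (m + 1)))
      + 3 * real m * real m + 3 * real m + 2" for m
    using arg_cong[OF card_corner_cuts_step[of m], of real] by simp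
  have eq: "2 * Suc k + 1 = 2 * k + 3" "2 * Suc k + 2 = (2 * k + 1) + 3" "(2 * k + 1) + 1 = 2 * k + 2"
    by simp_all
  {
    case 1
    show ?case
      unfolding eq using step[of "2 * k"] unfolding Suc by (simp add: field_simps power_def)
  next
    case 2
    show ?case
      unfolding eq using step[of "2 * k + 1"] unfolding eq(3) Suc
      by (simp add: field_simps power_def)
  }
qed (simp_all add: corner_cuts_small)

section \<open>Iterated sums of the corner-cut counts\<close>

text \<open>Peeling off one term changes the parity of the upper limit, so the odd and even closed
  forms are proved by passing alternately from one to the other.\<close>

lemma sum_atMost_Suc_Suc:
  fixes g :: "nat \<Rightarrow> real"
  shows "(\<Sum>i\<le>2 * Suc k + 1. g i) = (\<Sum>i\<le>2 * k + 2. g i) + g (2 * Suc k + 1)"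
    and "(\<Sum>i\<le>2 * k + 2. g i) = (\<Sum>i\<le>2 * k + 1. g i) + g (2 * k + 2)"
  by simp_all

text \<open>The polynomials for the iterated sums of \<open>card \<circ> corner_cuts\<close> are found by interpolation,
  separately for odd and for even arguments.\<close>

lemma sum_card_corner_cuts:
  "(\<Sum>m\<le>2 * k + 1. real (card (corner_cuts m))) = real k ^ 4"
  "(\<Sum>m\<le>2 * k + 2. real (card (corner_cuts m))) =
     real k ^ 4 + 2 * real k ^ 3 + 3/2 * real k ^ 2 + 1/2 * real k"
proof (induction k)
  case (Suc k)
  \<comment> \<open>The odd case comes first: the even sum for \<open>Suc k\<close> extends it by
    one term.\<close>
  have 1: "(\<Sum>m\<le>2 * Suc k + 1. real (card (corner_cuts m))) = real (Suc k) ^ 4"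
    unfolding sum_atMost_Suc_Suc(1) Suc card_corner_cuts
    by (simp add: field_simps power_def)
  {
    case 1 show ?case by (fact 1)
  next
    case 2 show ?case
      unfolding sum_atMost_Suc_Suc(2) 1 card_corner_cuts by (simp add: field_simps power_def)
  }
qed (simp_all add: corner_cuts_small numeral_2_eq_2)

lemma sum2_card_corner_cuts:
  "(\<Sum>j\<le>2 * k + 1. \<Sum>m\<le>j. real (card (corner_cuts m))) =
     2/5 * real k ^ 5 + 1/2 * real k ^ 4 + 1/6 * real k ^ 3 - 1/15 * real k"
  "(\<Sum>j\<le>2 * k + 2. \<Sum>m\<le>j. real (card (corner_cuts m))) =
     2/5 * real k ^ 5 + 3/2 * real k ^ 4 + 13/6 * real k ^ 3 + 3/2 * real k ^ 2 + 13/30 * real k"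
proof (induction k)
  case (Suc k)
  have 1: "(\<Sum>j\<le>2 * Suc k + 1. \<Sum>m\<le>j. real (card (corner_cuts m))) =
      2/5 * real (Suc k) ^ 5 + 1/2 * real (Suc k) ^ 4 + 1/6 * real (Suc k) ^ 3
      - 1/15 * real (Suc k)"
    unfolding sum_atMost_Suc_Suc(1)[of "\<lambda>j. \<Sum>m\<le>j. real (card (corner_cuts m))"] Suc
      sum_card_corner_cuts
    by (simp add: field_simps power_def)
  {
    case 1 show ?case by (fact 1)
  next
    case 2 show ?case
      unfolding sum_atMost_Suc_Suc(2)[of "\<lambda>j. \<Sum>m\<le>j. real (card (corner_cuts m))"] 1
        sum_card_corner_cuts
      by (simp add: field_simps power_def)
  }
qed (simp_all add: corner_cuts_small numeral_2_eq_2)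

lemma sum3_card_corner_cuts:
  "(\<Sum>i\<le>2 * k + 1. \<Sum>j\<le>i. \<Sum>m\<le>j. real (card (corner_cuts m))) =
     2/15 * real k ^ 6 + 2/5 * real k ^ 5 + 5/12 * real k ^ 4 + 1/6 * real k ^ 3
     - 1/20 * real k ^ 2 - 1/15 * real k"
  "(\<Sum>i\<le>2 * k + 2. \<Sum>j\<le>i. \<Sum>m\<le>j. real (card (corner_cuts m))) =
     2/15 * real k ^ 6 + 4/5 * real k ^ 5 + 23/12 * real k ^ 4 + 7/3 * real k ^ 3
     + 29/20 * real k ^ 2 + 11/30 * real k"
proof (induction k)
  case (Suc k)
  let ?g = "\<lambda>i. \<Sum>j\<le>i. \<Sum>m\<le>j. real (card (corner_cuts m))"
  have 1: "(\<Sum>i\<le>2 * Suc k + 1. ?g i) =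
      2/15 * real (Suc k) ^ 6 + 2/5 * real (Suc k) ^ 5 + 5/12 * real (Suc k) ^ 4
      + 1/6 * real (Suc k) ^ 3 - 1/20 * real (Suc k) ^ 2 - 1/15 * real (Suc k)"
    unfolding sum_atMost_Suc_Suc(1)[of ?g] Suc sum2_card_corner_cuts
    by (simp add: field_simps power_def)
  {
    case 1 show ?case by (fact 1)
  next
    case 2 show ?case
      unfolding sum_atMost_Suc_Suc(2)[of ?g] 1 sum2_card_corner_cuts
      by (simp add: field_simps power_def)
  }
qed (simp_all add: corner_cuts_small numeral_2_eq_2)

section \<open>Counting the admissible bounds\<close>

text \<open>The gaps in the six inequalities are the lengths, in coordinate units, of the sides on
  the bounds \<open>a\<close>, \<open>b\<close>, \<open>c\<close>, \<open>a'\<close>,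
  \<open>b'\<close>, \<open>c'\<close>, in this order: on \<open>x = a\<close>, say,
  \<open>y\<close> runs from \<open>n - a - c'\<close> to \<open>b'\<close>. They force
  \<open>a < a' < n\<close>, and likewise for the other two pairs.\<close>

definition hexagon_bounds :: "nat \<Rightarrow> (nat \<times> nat \<times> nat \<times> nat \<times> nat \<times> nat) set" where
  "hexagon_bounds n = {(a, a', b, b', c, c').
     n < a + b' + c' \<and> n < a' + b + c' \<and> n < a' + b' + c \<and>
     a' + b + c < n \<and> a + b' + c < n \<and> a + b + c' < n}"

lemma sum_atMost_diff_reindex: "(\<Sum>i\<le>n. g (n - i)) = (\<Sum>i\<le>n. g i)" for n :: nat
  by (rule sum.reindex_bij_witness[of _ "\<lambda>i. n - i" "\<lambda>i. n - i"]) auto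

text \<open>The lower bounds cut out a triangle of size \<open>m = n - a - b - c\<close>, and the upper bounds remove
  small triangles of sizes \<open>u\<close>, \<open>v\<close>, \<open>w\<close> from its corners.\<close>

lemma card_hexagon_bounds:
  "finite (hexagon_bounds n)"
  "card (hexagon_bounds n) = (\<Sum>i\<le>n. \<Sum>j\<le>i. \<Sum>m\<le>j. card (corner_cuts m))"
proof -
  let ?T = "SIGMA a:{..n}. SIGMA b:{..n - a}. SIGMA c:{..n - a - b}. corner_cuts (n - a - b - c)"
  \<comment> \<open>On the triangle given by the lower bounds \<open>x\<close> is at most
    \<open>n - b - c\<close>, so a cut of size \<open>u\<close> at that corner puts the upper bound
    at \<open>n - b - c - u\<close>. On \<open>?T\<close> no subtraction is truncated, since
    \<open>u\<close>, \<open>v\<close>, \<open>w\<close> are below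
    \<open>n - a - b - c\<close>.\<close>
  let ?f = "\<lambda>(a, b, c, u, v, w).
    (a, n - b - c - u, b, n - a - c - v, c, n - a - b - w)"
  let ?g = "\<lambda>(a, a', b, b', c, c').
    (a, b, c, n - b - c - a', n - a - c - b', n - a - b - c')"
  have bij: "bij_betw ?f ?T (hexagon_bounds n)"
    by (rule bij_betw_byWitness[of _ ?g]) (auto simp: hexagon_bounds_def corner_cuts_def)
  show "finite (hexagon_bounds n)"
    using bij_betw_finite[OF bij] by (simp add: finite_corner_cuts)
  have "card (hexagon_bounds n) = card ?T"
    using bij_betw_same_card[OF bij] by simp
  also have "\<dots> = (\<Sum>a\<le>n. \<Sum>b\<le>n - a. \<Sum>c\<le>n - a - b. card (corner_cuts (n - a - b - c)))"
    by (simp add: finite_corner_cuts)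
  also have "\<dots> = (\<Sum>i\<le>n. \<Sum>j\<le>i. \<Sum>m\<le>j. card (corner_cuts m))"
    by (simp only: sum_atMost_diff_reindex[where g = "\<lambda>m. card (corner_cuts m)"]
      sum_atMost_diff_reindex[where g = "\<lambda>i. \<Sum>m\<le>i. card (corner_cuts m)"]
      sum_atMost_diff_reindex[where g = "\<lambda>i. \<Sum>j\<le>i. \<Sum>m\<le>j. card (corner_cuts m)"])
  finally show "card (hexagon_bounds n) = (\<Sum>i\<le>n. \<Sum>j\<le>i. \<Sum>m\<le>j. card (corner_cuts m))" .
qed

lemma card_hexagon_bounds_odd:
  "real (card (hexagon_bounds (2 * k + 1))) =
     1 / 60 * (8 * real k ^ 6 + 24 * real k ^ 5 + 25 * real k ^ 4
               + 10 * real k ^ 3 - 3 * real k ^ 2 - 4 * real k)"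
  unfolding card_hexagon_bounds(2) of_nat_sum sum3_card_corner_cuts by (simp add: field_simps)

lemma card_hexagon_bounds_even:
  assumes "k \<ge> 1"
  shows "real (card (hexagon_bounds (2 * k))) =
     1 / 60 * (8 * real k ^ 6 - 5 * real k ^ 4 - 3 * real k ^ 2)"
proof -
  obtain j where k: "k = Suc j" using assms by (cases k) auto
  then have "2 * k = 2 * j + 2" by simp
  then show ?thesis
    unfolding card_hexagon_bounds(2) of_nat_sum k
    by (simp only: sum3_card_corner_cuts) (simp add: field_simps power_def)
qed

section \<open>Affine forms and the edges of plane polytopes\<close>

text \<open>The condition \<open>a \<noteq> 0\<close> makes every level set a line.\<close>

definition affine_form :: "(real^2 \<Rightarrow> real) \<Rightarrow> bool" where
  "affine_form f \<longleftrightarrow> (\<exists>a b. a \<noteq> 0 \<and> (\<forall>p. f p = a \<bullet> p + b))"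

lemma affine_form_combination:
  assumes "affine_form f"
  shows "f ((1 - u) *\<^sub>R p + u *\<^sub>R q) = (1 - u) * f p + u * f q"
proof -
  obtain a b where f: "\<And>p. f p = a \<bullet> p + b" using assms by (auto simp: affine_form_def)
  show ?thesis by (simp add: f inner_add_right algebra_simps)
qed

lemma continuous_on_affine_form: "affine_form f \<Longrightarrow> continuous_on S f"
  by (auto simp: affine_form_def intro!: continuous_intros cong: continuous_on_cong)

lemma polyhedron_affine_form:
  assumes "affine_form f"
  shows "polyhedron {p. f p \<le> c}" "polyhedron {p. c \<le> f p}"
proof -
  obtain a b where f: "\<And>p. f p = a \<bullet> p + b" using assms by (auto simp: affine_form_def)
  have "{p. f p \<le> c} = {p. a \<bullet> p \<le> c - b}" "{p. c \<le> f p} = {p. a \<bullet> p \<ge> c - b}"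
    by (auto simp: f)
  then show "polyhedron {p. f p \<le> c}" "polyhedron {p. c \<le> f p}"
    by (simp_all add: polyhedron_halfspace_le polyhedron_halfspace_ge)
qed

lemma face_of_affine_form:
  assumes "affine_form f" "convex S" "(\<forall>p\<in>S. c \<le> f p) \<or> (\<forall>p\<in>S. f p \<le> c)"
  shows "S \<inter> {p. f p = c} face_of S"
proof -
  obtain a b where f: "\<And>p. f p = a \<bullet> p + b" using assms by (auto simp: affine_form_def)
  have "{p. f p = c} = {p. a \<bullet> p = c - b}" by (auto simp: f)
  moreover have "(\<forall>p\<in>S. c - b \<le> a \<bullet> p) \<or> (\<forall>p\<in>S. a \<bullet> p \<le> c - b)"
    using assms(3) by (simp add: f algebra_simps)
  ultimately show ?thesis
    using face_of_Int_supporting_hyperplane_le[OF assms(2), of a "c - b"]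
      face_of_Int_supporting_hyperplane_ge[OF assms(2), of "c - b" a] by auto
qed

text \<open>In the plane the vectors orthogonal to a nonzero \<open>w\<close> form a line: both
  coordinates of \<open>w\<close> are annihilated by the determinant of \<open>a'\<close> and
  \<open>a\<close>, which therefore vanishes.\<close>

lemma parallel_of_common_normal:
  fixes a a' w :: "real^2"
  assumes "w \<noteq> 0" "a \<noteq> 0" "a \<bullet> w = 0" "a' \<bullet> w = 0"
  obtains t where "a' = t *\<^sub>R a"
proof -
  have *: "a$1 * w$1 + a$2 * w$2 = 0" "a'$1 * w$1 + a'$2 * w$2 = 0"
    using assms(3,4) by (simp_all add: inner_vec_def sum_2)
  have "w$1 * (a'$1 * a$2 - a'$2 * a$1) = 0" "w$2 * (a'$1 * a$2 - a'$2 * a$1) = 0"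
    using * by algebra+
  moreover have "w$1 \<noteq> 0 \<or> w$2 \<noteq> 0" using assms(1) by (auto simp: vec_eq_iff forall_2)
  ultimately have det: "a'$1 * a$2 = a'$2 * a$1" by auto
  consider "a$1 \<noteq> 0" | "a$2 \<noteq> 0" using assms(2) by (auto simp: vec_eq_iff forall_2)
  then show ?thesis
  proof cases
    case 1 then show ?thesis
      using det by (intro that[of "a'$1 / a$1"]) (auto simp: vec_eq_iff forall_2 field_simps)
  next
    case 2 then show ?thesis
      using det by (intro that[of "a'$2 / a$2"]) (auto simp: vec_eq_iff forall_2 field_simps)
  qed
qed

lemma aff_dim_1_two_points:
  assumes "aff_dim e = 1"
  obtains p q where "p \<in> e" "q \<in> e" "p \<noteq> q"
proof -
  have "e \<noteq> {}" using assms by auto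
  then obtain p where "p \<in> e" by auto
  moreover have "e \<noteq> {p}" using assms by auto
  ultimately show ?thesis using that by blast
qed

lemma edge_of_eq_facet_of:
  assumes "aff_dim P = 2"
  shows "e edge_of P \<longleftrightarrow> e facet_of P"
  using assms by (auto simp: edge_of_def facet_of_def)

text \<open>An edge of a plane polygon is a facet, so it is cut out by a supporting line. It has two
  distinct points, and the normals of both lines are orthogonal to their difference; so the lines
  coincide, and \<open>f - c\<close> has constant sign on \<open>P\<close>.\<close>

lemma edge_on_affine_form:
  assumes "polyhedron P" "aff_dim P = 2" "e edge_of P" "affine_form f" "e \<subseteq> {p. f p = c}"
  shows "e = P \<inter> {p. f p = c}" "(\<forall>p\<in>P. c \<le> f p) \<or> (\<forall>p\<in>P. f p \<le> c)"
proof -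
  obtain a b where a: "a \<noteq> 0" and f: "\<And>p. f p = a \<bullet> p + b"
    using assms(4) by (auto simp: affine_form_def)
  obtain a' b' where a': "a' \<noteq> 0" "P \<subseteq> {p. a' \<bullet> p \<le> b'}" "e = P \<inter> {p. a' \<bullet> p = b'}"
    using facet_of_polyhedron assms(1-3) edge_of_eq_facet_of by metis
  obtain p q where pq: "p \<in> e" "q \<in> e" "p \<noteq> q"
    using aff_dim_1_two_points assms(3) by (auto simp: edge_of_def)
  have pq': "f p = c" "f q = c" "a' \<bullet> p = b'" "a' \<bullet> q = b'"
    using pq assms(5) a'(3) by auto
  then have "a \<bullet> (p - q) = 0" "a' \<bullet> (p - q) = 0"
    by (auto simp: f inner_diff_right)
  then obtain t where t: "a' = t *\<^sub>R a"
    using parallel_of_common_normal[of "p - q" a a'] a pq(3) by auto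
  have t0: "t \<noteq> 0" using t a'(1) by auto
  have eq: "a' \<bullet> r - b' = t * (f r - c)" for r
    unfolding pq'(1)[symmetric] pq'(3)[symmetric] by (simp add: t f algebra_simps)
  have "a' \<bullet> r = b' \<longleftrightarrow> f r = c" for r using eq[of r] t0 by auto
  then show "e = P \<inter> {p. f p = c}" unfolding a'(3) by simp
  have le: "t * (f r - c) \<le> 0" if "r \<in> P" for r
    using a'(2) that eq[of r] by fastforce
  show "(\<forall>p\<in>P. c \<le> f p) \<or> (\<forall>p\<in>P. f p \<le> c)"
  proof (cases "t > 0")
    case True
    then show ?thesis using le by (auto simp: mult_le_0_iff)
  next
    case False
    then have "t < 0" using t0 by simp
    then show ?thesis using le by (auto simp: mult_le_0_iff)
  qed
qed

text \<open>Double counting: a vertex is the intersection of the edges through it, so it lies on at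
  least two of them, whereas an edge contains at most two vertices.\<close>

lemma card_vertices_le_card_edges:
  fixes P :: "'a::euclidean_space set"
  assumes "polytope P" "aff_dim P = 2"
  shows "card {v. v extreme_point_of P} \<le> card {e. e edge_of P}"
proof -
  let ?V = "{v. v extreme_point_of P}" and ?E = "{e. e edge_of P}"
  have poly: "polyhedron P" using assms(1) polytope_imp_polyhedron by blast
  have finE: "finite ?E"
    using finite_polytope_faces[OF assms(1)] by (rule rev_finite_subset) (auto simp: edge_of_def)
  have finV: "finite ?V" by (rule finite_polyhedron_extreme_points[OF poly])
  have edge: "card {v \<in> ?V. v \<in> e} \<le> 2" if e: "e \<in> ?E" for e
  proof -
    have face: "e face_of P" and dim: "aff_dim e = 1" using e by (auto simp: edge_of_def)
    have pe: "polytope e" by (rule face_of_polytope_polytope[OF assms(1) face])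
    have "e \<noteq> {}" "collinear e" using dim by (auto simp: collinear_aff_dim)
    then obtain u v where uv: "e = closed_segment u v"
      using compact_convex_collinear_segment[of e] pe polytope_imp_compact polytope_imp_convex
      by metis
    have "{v \<in> ?V. v \<in> e} = {v. v extreme_point_of e}"
      using extreme_point_of_face[OF face] by auto
    also have "\<dots> = {u, v}" by (auto simp: uv extreme_point_of_segment)
    finally show ?thesis by (simp add: card_insert_if)
  qed
  have vertex: "2 \<le> card {e \<in> ?E. v \<in> e}" if v: "v \<in> ?V" for v
  proof (rule ccontr)
    assume "\<not> 2 \<le> card {e \<in> ?E. v \<in> e}"
    then have le1: "card {e \<in> ?E. v \<in> e} \<le> 1" by simp
    \<comment> \<open>As a proper face, \<open>{v}\<close> is the intersection of the facets
      containing it. With no such edge this would be \<open>UNIV\<close>, with exactly one it would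
      be that edge, and neither is a single point.\<close>
    have "{v} face_of P" using v by (simp add: face_of_singleton)
    moreover have "{v} \<noteq> P" using assms(2) by auto
    ultimately have eq: "{v} = \<Inter>{F. F facet_of P \<and> {v} \<subseteq> F}"
      using face_of_polyhedron[OF poly] by blast
    have sets: "{F. F facet_of P \<and> {v} \<subseteq> F} = {e \<in> ?E. v \<in> e}"
      using edge_of_eq_facet_of[OF assms(2)] by auto
    have "{v} \<noteq> UNIV" using assms(2) aff_dim_subset[of P "{v}"] by auto
    then have "{e \<in> ?E. v \<in> e} \<noteq> {}" using eq unfolding sets by force
    then have "card {e \<in> ?E. v \<in> e} > 0" using finE by (simp add: card_gt_0_iff)
    then have "card {e \<in> ?E. v \<in> e} = 1" using le1 by linarith
    then obtain e where e: "{e \<in> ?E. v \<in> e} = {e}" by (rule card_1_singletonE)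
    then have "{v} = e" using eq unfolding sets by simp
    moreover have "e edge_of P" using e by blast
    ultimately show False by (auto simp: edge_of_def)
  qed
  have "2 * card ?V \<le> (\<Sum>v\<in>?V. card {e \<in> ?E. v \<in> e})"
    using sum_bounded_below[of ?V 2 "\<lambda>v. card {e \<in> ?E. v \<in> e}"] vertex by (simp add: mult.commute)
  also have "\<dots> = (\<Sum>e\<in>?E. card {v \<in> ?V. v \<in> e})"
    using sum.swap_restrict[OF finV finE, of "\<lambda>_ _. 1::nat" "\<lambda>v e. v \<in> e"] by simp
  also have "\<dots> \<le> 2 * card ?E"
    using sum_bounded_above[of ?E "\<lambda>e. card {v \<in> ?V. v \<in> e}" 2] edge by (simp add: mult.commute)
  finally show ?thesis by simp
qed

section \<open>Hexagons given by coordinate bounds\<close>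

text \<open>This replaces the triangle by scaled barycentric coordinates: \<open>x\<close> and
  \<open>y\<close> identify the plane with the pairs of reals, and \<open>z\<close> is fixed by the
  sum.\<close>

locale net_coordinates =
  fixes n :: nat and x y z :: "real^2 \<Rightarrow> real"
  assumes affine: "affine_form x" "affine_form y" "affine_form z"
    and sum_eq: "x p + y p + z p = real n"
    and ex_point: "\<exists>p. x p = s \<and> y p = t"
    and eq_point: "x p = x q \<Longrightarrow> y p = y q \<Longrightarrow> p = q"
begin

text \<open>The index 0 gives the sides of the triangle; at \<open>n\<close> the line would meet the
  triangle in a vertex only. The cyclic order of the conditions lets one description of the segments
  serve all three directions by rotating the vertices.\<close>

definition net_segments :: "(real^2) set set" where
  "net_segments =
     {{p. x p = real i \<and> 0 \<le> y p \<and> 0 \<le> z p} | i. i < n} \<union>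
     {{p. y p = real i \<and> 0 \<le> z p \<and> 0 \<le> x p} | i. i < n} \<union>
     {{p. z p = real i \<and> 0 \<le> x p \<and> 0 \<le> y p} | i. i < n}"

definition hexagon :: "nat \<times> nat \<times> nat \<times> nat \<times> nat \<times> nat \<Rightarrow> (real^2) set" where
  "hexagon = (\<lambda>(a, a', b, b', c, c'). {p. real a \<le> x p \<and> x p \<le> real a' \<and>
     real b \<le> y p \<and> y p \<le> real b' \<and> real c \<le> z p \<and> z p \<le> real c'})"

text \<open>The inverse of the coordinate map is affine, being built from the points with
  coordinates \<open>(0, 0)\<close>, \<open>(1, 0)\<close>, \<open>(0, 1)\<close>. Its continuity
  yields boundedness of hexagons, and its midpoint property excludes false vertices.\<close>

lemma point_with_coordinates:
  obtains pt :: "real \<Rightarrow> real \<Rightarrow> real^2" where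
    "\<And>s t. x (pt s t) = s" "\<And>s t. y (pt s t) = t" "\<And>s t. z (pt s t) = real n - s - t"
    "\<And>p. pt (x p) (y p) = p" "continuous_on UNIV (\<lambda>(s, t). pt s t)"
    "\<And>s t d e. midpoint (pt (s + d) (t + e)) (pt (s - d) (t - e)) = pt s t"
proof -
  obtain o' px py where o': "x o' = 0" "y o' = 0" and px: "x px = 1" "y px = 0"
    and py: "x py = 0" "y py = 1"
    using ex_point by metis
  define pt where "pt s t = o' + s *\<^sub>R (px - o') + t *\<^sub>R (py - o')" for s t
  have form: "f (pt s t) = f o' + s * (f px - f o') + t * (f py - f o')" if f: "affine_form f" for f s t
  proof -
    obtain a b where f: "\<And>p. f p = a \<bullet> p + b" using f by (auto simp: affine_form_def)
    show ?thesis by (simp add: f pt_def algebra_simps)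
  qed
  have xy: "x (pt s t) = s" "y (pt s t) = t" for s t
    using form[OF affine(1)] form[OF affine(2)] o' px py by simp_all
  show ?thesis
  proof (rule that)
    show "z (pt s t) = real n - s - t" for s t using sum_eq[of "pt s t"] xy[of s t] by simp
    show "pt (x p) (y p) = p" for p by (rule eq_point) (simp_all add: xy)
    show "continuous_on UNIV (\<lambda>(s, t). pt s t)"
      by (auto simp: pt_def case_prod_unfold intro!: continuous_intros)
    show "midpoint (pt (s + d) (t + e)) (pt (s - d) (t - e)) = pt s t" for s t d e
      by (simp add: pt_def midpoint_def vec_eq_iff field_simps)
  qed (simp_all add: xy)
qed

text \<open>It is an intersection of six half-planes and lies in the image of a compact rectangle
  under the inverse coordinate map.\<close>

lemma polytope_hexagon: "polytope (hexagon t)"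
proof -
  obtain a a' b b' c c' where t: "t = (a, a', b, b', c, c')" by (cases t)
  have "hexagon t = {p. real a \<le> x p} \<inter> {p. x p \<le> real a'} \<inter> {p. real b \<le> y p} \<inter>
      {p. y p \<le> real b'} \<inter> {p. real c \<le> z p} \<inter> {p. z p \<le> real c'}"
    by (auto simp: hexagon_def t)
  then have "polyhedron (hexagon t)"
    by (simp add: polyhedron_affine_form affine)
  moreover obtain pt where pt: "\<And>p. pt (x p) (y p) = p" "continuous_on UNIV (\<lambda>(s, t). pt s t)"
    using point_with_coordinates by metis
  have "bounded ((\<lambda>(s, t). pt s t) ` ({real a..real a'} \<times> {real b..real b'}))"
    using compact_continuous_image[OF continuous_on_subset[OF pt(2)]]
    by (intro compact_imp_bounded) (auto intro: compact_Times)
  then have "bounded (hexagon t)"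
    by (rule bounded_subset) (force simp: hexagon_def t image_iff pt(1)[symmetric])
  ultimately show ?thesis by (simp add: polytope_eq_bounded_polyhedron)
qed

lemma interior_hexagon:
  "{p. real a < x p \<and> x p < real a' \<and> real b < y p \<and> y p < real b' \<and> real c < z p \<and> z p < real c'}
   \<subseteq> interior (hexagon (a, a', b, b', c, c'))" (is "?S \<subseteq> _")
proof (rule interior_maximal)
  show "open ?S"
    by (intro open_Collect_conj open_Collect_less continuous_on_const
        continuous_on_affine_form affine)
qed (auto simp: hexagon_def)

context
  fixes a a' b b' c c' :: nat
  assumes bounds: "(a, a', b, b', c, c') \<in> hexagon_bounds n"
begin

lemma real_bounds:
  "real n < real a + real b' + real c'" "real n < real a' + real b + real c'"
  "real n < real a' + real b' + real c" "real a' + real b + real c < real n"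
  "real a + real b' + real c < real n" "real a + real b + real c' < real n"
  using bounds by (auto simp: hexagon_bounds_def)

lemma aff_dim_hexagon: "aff_dim (hexagon (a, a', b, b', c, c')) = 2"
proof -
  obtain pt where pt: "\<And>s t. x (pt s t) = s" "\<And>s t. y (pt s t) = t"
    "\<And>s t. z (pt s t) = real n - s - t"
    using point_with_coordinates by metis
  \<comment> \<open>the centroid of three alternate vertices\<close>
  have "pt ((real a + (real n - b - c') + a') / 3) ((real b' + b + (real n - a' - c)) / 3)
      \<in> interior (hexagon (a, a', b, b', c, c'))"
    using real_bounds by (intro subsetD[OF interior_hexagon]) (auto simp: pt field_simps)
  then show ?thesis
    using aff_dim_nonempty_interior[of "hexagon (a, a', b, b', c, c')"] by auto
qed

lemma hexagon_faces:
  defines "H \<equiv> hexagon (a, a', b, b', c, c')"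
  shows "H \<inter> {p. x p = a} face_of H" "H \<inter> {p. x p = a'} face_of H"
    "H \<inter> {p. y p = b} face_of H" "H \<inter> {p. y p = b'} face_of H"
    "H \<inter> {p. z p = c} face_of H" "H \<inter> {p. z p = c'} face_of H"
proof -
  have "convex H" unfolding H_def by (intro polytope_imp_convex polytope_hexagon)
  then show "H \<inter> {p. x p = a} face_of H" "H \<inter> {p. x p = a'} face_of H"
    "H \<inter> {p. y p = b} face_of H" "H \<inter> {p. y p = b'} face_of H"
    "H \<inter> {p. z p = c} face_of H" "H \<inter> {p. z p = c'} face_of H"
    by (intro face_of_affine_form affine, assumption, force simp: H_def hexagon_def)+
qed

text \<open>At an extreme point, bounds of two different coordinates are attained, one lower and one
  upper. Conversely each such pair gives a vertex as the intersection of two faces.\<close>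

lemma card_vertices_hexagon: "card {v. v extreme_point_of hexagon (a, a', b, b', c, c')} = 6"
proof -
  let ?H = "hexagon (a, a', b, b', c, c')"
  obtain pt where pt: "\<And>s t. x (pt s t) = s" "\<And>s t. y (pt s t) = t"
    "\<And>s t. z (pt s t) = real n - s - t" "\<And>p. pt (x p) (y p) = p"
    "\<And>s t d e. midpoint (pt (s + d) (t + e)) (pt (s - d) (t - e)) = pt s t"
    using point_with_coordinates by metis
  have pt_inj: "pt s t = pt s' t' \<longleftrightarrow> s = s' \<and> t = t'" for s t s' t'
    by (metis pt(1,2))
  \<comment> \<open>The candidates in the coordinates \<open>(x, y)\<close>; where a bound of
    \<open>z\<close> is attained, the missing coordinate comes from the sum
    \<open>n\<close>.\<close>
  let ?W = "{(real a, real b'), (real a', real b), (real a, real n - a - c'), (real a', real n - a' - c),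
    (real n - b - c', real b), (real n - b' - c, real b')}"
  have "v \<in> (\<lambda>(s, t). pt s t) ` ?W" if v: "v extreme_point_of ?H" for v
  proof -
    have H: "a \<le> x v" "x v \<le> a'" "b \<le> y v" "y v \<le> b'" "c \<le> z v" "z v \<le> c'"
      using v by (auto simp: extreme_point_of_def hexagon_def)
    have not_mid: "pt (x v + d) (y v + e) \<notin> ?H \<or> pt (x v - d) (y v - e) \<notin> ?H"
      if "d \<noteq> 0 \<or> e \<noteq> 0" for d e
    proof -
      have "pt (x v + d) (y v + e) \<noteq> pt (x v - d) (y v - e)" using that by (auto simp: pt_inj)
      then have "v \<in> open_segment (pt (x v + d) (y v + e)) (pt (x v - d) (y v - e))"
        using midpoint_in_open_segment[of "pt (x v + d) (y v + e)" "pt (x v - d) (y v - e)"]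
        by (simp add: pt)
      then show ?thesis using v by (auto simp: extreme_point_of_def)
    qed
    have s: "z v = n - x v - y v" using sum_eq[of v] by simp
    \<comment> \<open>If all bounds of two coordinates are slack, a short move in both directions
      with the third coordinate fixed stays inside, so \<open>v\<close> would be a midpoint. The
      shifts \<open>(0, e)\<close>, \<open>(e, 0)\<close>, \<open>(e, - e)\<close> fix
      \<open>x\<close>, \<open>y\<close>, \<open>z\<close> in turn.\<close>
    have yz: "y v = b \<or> y v = b' \<or> z v = c \<or> z v = c'"
    proof (rule ccontr)
      assume n: "\<not> ?thesis"
      define e where "e = min (min (y v - b) (b' - y v)) (min (z v - c) (c' - z v))"
      have "e > 0" using n H by (auto simp: e_def)
      moreover have "e \<le> y v - b" "e \<le> b' - y v" "e \<le> z v - c" "e \<le> c' - z v"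
        by (simp_all add: e_def)
      ultimately show False using not_mid[of 0 e] H by (auto simp: hexagon_def pt s)
    qed
    have xz: "x v = a \<or> x v = a' \<or> z v = c \<or> z v = c'"
    proof (rule ccontr)
      assume n: "\<not> ?thesis"
      define e where "e = min (min (x v - a) (a' - x v)) (min (z v - c) (c' - z v))"
      have "e > 0" using n H by (auto simp: e_def)
      moreover have "e \<le> x v - a" "e \<le> a' - x v" "e \<le> z v - c" "e \<le> c' - z v"
        by (simp_all add: e_def)
      ultimately show False using not_mid[of e 0] H by (auto simp: hexagon_def pt s)
    qed
    have xy: "x v = a \<or> x v = a' \<or> y v = b \<or> y v = b'"
    proof (rule ccontr)
      assume n: "\<not> ?thesis"
      define e where "e = min (min (x v - a) (a' - x v)) (min (y v - b) (b' - y v))"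
      have "e > 0" using n H by (auto simp: e_def)
      moreover have "e \<le> x v - a" "e \<le> a' - x v" "e \<le> y v - b" "e \<le> b' - y v"
        by (simp_all add: e_def)
      ultimately show False using not_mid[of e "- e"] H by (auto simp: hexagon_def pt s)
    qed
    \<comment> \<open>Two lower bounds would push the third coordinate above its upper bound, and
      two upper bounds would push it below its lower bound.\<close>
    have "\<not> (x v = a \<and> y v = b)" "\<not> (x v = a' \<and> y v = b')" "\<not> (x v = a \<and> z v = c)"
      "\<not> (x v = a' \<and> z v = c')" "\<not> (y v = b \<and> z v = c)" "\<not> (y v = b' \<and> z v = c')"
      using H s real_bounds by linarith+
    then consider "x v = a" "y v = b'" | "x v = a'" "y v = b" | "x v = a" "z v = c'"
      | "x v = a'" "z v = c" | "y v = b" "z v = c'" | "y v = b'" "z v = c"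
      using xy xz yz by blast
    then have "(x v, y v) \<in> ?W"
    proof cases
      case 3 then have "y v = real n - a - c'" using s by simp
      with 3 show ?thesis by simp
    next
      case 4 then have "y v = real n - a' - c" using s by simp
      with 4 show ?thesis by simp
    next
      case 5 then have "x v = real n - b - c'" using s by simp
      with 5 show ?thesis by simp
    next
      case 6 then have "x v = real n - b' - c" using s by simp
      with 6 show ?thesis by simp
    qed simp_all
    then show ?thesis by (intro image_eqI[of _ _ "(x v, y v)"]) (simp_all add: pt)
  qed
  moreover have "v extreme_point_of ?H" if v: "v \<in> (\<lambda>(s, t). pt s t) ` ?W" for v
  proof -
    have in_H: "v \<in> ?H" using v real_bounds by (auto simp: hexagon_def pt)
    have ext: "v extreme_point_of ?H"
      if "F face_of ?H" "G face_of ?H" "v \<in> F" "v \<in> G" "\<And>p. p \<in> F \<Longrightarrow> p \<in> G \<Longrightarrow> p = v" for F G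
    proof -
      have "F \<inter> G = {v}" using that by blast
      then show ?thesis using face_of_Int[OF that(1,2)] by (simp add: face_of_singleton)
    qed
    have eq: "p = v" if "x p = x v \<and> y p = y v \<or> x p = x v \<and> z p = z v \<or> y p = y v \<and> z p = z v" for p
      using that sum_eq[of p] sum_eq[of v] by (intro eq_point) auto
    consider "x v = a" "y v = b'" | "x v = a'" "y v = b" | "x v = a" "z v = c'"
      | "x v = a'" "z v = c" | "y v = b" "z v = c'" | "y v = b'" "z v = c"
      using v by (auto simp: pt)
    then show ?thesis
    proof cases
      case 1 then show ?thesis using in_H by (intro ext[OF hexagon_faces(1,4)]) (auto intro!: eq)
    next
      case 2 then show ?thesis using in_H by (intro ext[OF hexagon_faces(2,3)]) (auto intro!: eq)
    next
      case 3 then show ?thesis using in_H by (intro ext[OF hexagon_faces(1,6)]) (auto intro!: eq)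
    next
      case 4 then show ?thesis using in_H by (intro ext[OF hexagon_faces(2,5)]) (auto intro!: eq)
    next
      case 5 then show ?thesis using in_H by (intro ext[OF hexagon_faces(3,6)]) (auto intro!: eq)
    next
      case 6 then show ?thesis using in_H by (intro ext[OF hexagon_faces(4,5)]) (auto intro!: eq)
    qed
  qed
  ultimately have "{v. v extreme_point_of ?H} = (\<lambda>(s, t). pt s t) ` ?W" by blast
  moreover have "card ((\<lambda>(s, t). pt s t) ` ?W) = card ?W"
    by (rule card_image) (auto simp: inj_on_def pt_inj)
  moreover have "card ?W = 6" using real_bounds by auto
  ultimately show ?thesis by simp
qed

text \<open>A relative interior point \<open>m\<close> of the edge is not interior to the hexagon,
  so some bound is attained at \<open>m\<close>. The face where that bound is attained contains
  \<open>m\<close>, hence the whole edge.\<close>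

lemma edge_of_hexagon:
  assumes "e edge_of hexagon (a, a', b, b', c, c')"
  shows "\<exists>s\<in>net_segments. e \<subseteq> s"
proof -
  let ?H = "hexagon (a, a', b, b', c, c')"
  have face: "e face_of ?H" and dim: "aff_dim e = 1" using assms by (auto simp: edge_of_def)
  then have "e \<noteq> {}" "e \<subseteq> ?H" "e \<noteq> ?H"
    using face_of_imp_subset aff_dim_hexagon by auto
  then obtain m where m: "m \<in> rel_interior e"
    using face_of_imp_convex[OF face] rel_interior_eq_empty by blast
  then have "m \<in> e" using rel_interior_subset by blast
  then have mH: "m \<in> ?H" using \<open>e \<subseteq> ?H\<close> by blast
  have "m \<notin> interior ?H"
    using face_of_disjoint_interior[OF face \<open>e \<noteq> ?H\<close>] \<open>m \<in> e\<close> by blast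
  then have tight: "x m = a \<or> x m = a' \<or> y m = b \<or> y m = b' \<or> z m = c \<or> z m = c'"
    using interior_hexagon[of a a' b b' c c'] mH unfolding hexagon_def by force
  have sub: "e \<subseteq> F" if "F face_of ?H" "m \<in> F" for F
    using subset_of_face_of[OF that(1) \<open>e \<subseteq> ?H\<close>] that(2) m by blast
  have less: "a < n" "a' < n" "b < n" "b' < n" "c < n" "c' < n"
    using bounds by (auto simp: hexagon_bounds_def)
  have nonneg: "0 \<le> x p" "0 \<le> y p" "0 \<le> z p" if "p \<in> ?H" for p
    using that by (auto simp: hexagon_def)
  have X: ?thesis if "e \<subseteq> ?H \<inter> {p. x p = real i}" "i < n" for i
  proof -
    have "{p. x p = real i \<and> 0 \<le> y p \<and> 0 \<le> z p} \<in> net_segments"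
      using that by (auto simp: net_segments_def)
    moreover have "e \<subseteq> {p. x p = real i \<and> 0 \<le> y p \<and> 0 \<le> z p}"
      using that nonneg by auto
    ultimately show ?thesis by (rule bexI[rotated])
  qed
  have Y: ?thesis if "e \<subseteq> ?H \<inter> {p. y p = real i}" "i < n" for i
  proof -
    have "{p. y p = real i \<and> 0 \<le> z p \<and> 0 \<le> x p} \<in> net_segments"
      using that by (auto simp: net_segments_def)
    moreover have "e \<subseteq> {p. y p = real i \<and> 0 \<le> z p \<and> 0 \<le> x p}"
      using that nonneg by auto
    ultimately show ?thesis by (rule bexI[rotated])
  qed
  have Z: ?thesis if "e \<subseteq> ?H \<inter> {p. z p = real i}" "i < n" for i
  proof -
    have "{p. z p = real i \<and> 0 \<le> x p \<and> 0 \<le> y p} \<in> net_segments"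
      using that by (auto simp: net_segments_def)
    moreover have "e \<subseteq> {p. z p = real i \<and> 0 \<le> x p \<and> 0 \<le> y p}"
      using that nonneg by auto
    ultimately show ?thesis by (rule bexI[rotated])
  qed
  show ?thesis using tight
  proof (elim disjE)
    assume "x m = a" then show ?thesis
      using X[OF sub[OF hexagon_faces(1)]] mH less by blast
  next
    assume "x m = a'" then show ?thesis
      using X[OF sub[OF hexagon_faces(2)]] mH less by blast
  next
    assume "y m = b" then show ?thesis
      using Y[OF sub[OF hexagon_faces(3)]] mH less by blast
  next
    assume "y m = b'" then show ?thesis
      using Y[OF sub[OF hexagon_faces(4)]] mH less by blast
  next
    assume "z m = c" then show ?thesis
      using Z[OF sub[OF hexagon_faces(5)]] mH less by blast
  next
    assume "z m = c'" then show ?thesis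
      using Z[OF sub[OF hexagon_faces(6)]] mH less by blast
  qed
qed

text \<open>The four vertices used in the proof together attain all six bounds of the smaller
  hexagon.\<close>

lemma hexagon_subset_imp_bounds:
  assumes "hexagon (a, a', b, b', c, c') \<subseteq> hexagon (i, i', j, j', k, k')"
  shows "i \<le> a" "a' \<le> i'" "j \<le> b" "b' \<le> j'" "k \<le> c" "c' \<le> k'"
proof -
  obtain pt where pt: "\<And>s t. x (pt s t) = s" "\<And>s t. y (pt s t) = t"
    "\<And>s t. z (pt s t) = real n - s - t"
    using point_with_coordinates by metis
  have "pt a b' \<in> hexagon (a, a', b, b', c, c')" "pt a' b \<in> hexagon (a, a', b, b', c, c')"
    "pt a (real n - a - c') \<in> hexagon (a, a', b, b', c, c')"
    "pt a' (real n - a' - c) \<in> hexagon (a, a', b, b', c, c')"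
    using real_bounds by (auto simp: hexagon_def pt)
  then have "pt a b' \<in> hexagon (i, i', j, j', k, k')" "pt a' b \<in> hexagon (i, i', j, j', k, k')"
    "pt a (real n - a - c') \<in> hexagon (i, i', j, j', k, k')"
    "pt a' (real n - a' - c) \<in> hexagon (i, i', j, j', k, k')"
    using assms by blast+
  then show "i \<le> a" "a' \<le> i'" "j \<le> b" "b' \<le> j'" "k \<le> c" "c' \<le> k'"
    by (auto simp: hexagon_def pt)
qed

end

lemma inj_on_hexagon: "inj_on hexagon (hexagon_bounds n)"
proof (rule inj_onI)
  fix s t assume st: "s \<in> hexagon_bounds n" "t \<in> hexagon_bounds n" "hexagon s = hexagon t"
  obtain a a' b b' c c' where s: "s = (a, a', b, b', c, c')" by (cases s)
  obtain i i' j j' k k' where t: "t = (i, i', j, j', k, k')" by (cases t)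
  show "s = t"
    using hexagon_subset_imp_bounds[of a a' b b' c c' i i' j j' k k']
      hexagon_subset_imp_bounds[of i i' j j' k k' a a' b b' c c'] st unfolding s t by auto
qed

section \<open>Classification of the convex hexagons in the net\<close>

text \<open>On an edge where \<open>f\<close> is constant, two distinct points differ in
  \<open>g\<close>. The one with larger \<open>g\<close> exceeds \<open>j\<close>, the other stays
  below \<open>j'\<close>, which makes the sums strict.\<close>

lemma edge_coordinate_bounds:
  assumes "aff_dim e = 1" "\<And>p. p \<in> e \<Longrightarrow> f p = real i \<and> real j \<le> g p \<and> g p \<le> real j' \<and>
      real k \<le> h p \<and> h p \<le> real k'"
    and "\<And>p. f p + g p + h p = real n" "\<And>p q. f p = f q \<Longrightarrow> g p = g q \<Longrightarrow> p = q"
  shows "i + j + k < n" "n < i + j' + k'"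
proof -
  obtain p q where pq: "p \<in> e" "q \<in> e" "p \<noteq> q" using aff_dim_1_two_points[OF assms(1)] .
  have "g p \<noteq> g q" using pq assms(2)[of p] assms(2)[of q] assms(4)[of p q] by auto
  then have "real (i + j + k) < real n \<and> real n < real (i + j' + k')"
    using assms(2)[OF pq(1)] assms(2)[OF pq(2)] assms(3)[of p] assms(3)[of q]
    by (cases "g p < g q") auto
  then show "i + j + k < n" "n < i + j' + k'" by linarith+
qed

text \<open>A side of \<open>P\<close> is encoded by a coordinate \<open>f\<close> and a sign \<open>s\<close>: \<open>s = 1\<close> if \<open>f\<close> is minimal on
  the side and \<open>s = -1\<close> if it is maximal. There are only six codes, so all of them occur.\<close>

lemma net_hexagon_imp_hexagon:
  assumes hex: "convex_hexagon P" and net: "\<And>e. e edge_of P \<Longrightarrow> \<exists>s\<in>net_segments. e \<subseteq> s"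
  shows "P \<in> hexagon ` hexagon_bounds n"
proof -
  have P: "polytope P" "aff_dim P = 2" "card {v. v extreme_point_of P} = 6"
    using hex by (auto simp: convex_hexagon_def)
  have poly: "polyhedron P" using P(1) polytope_imp_polyhedron by blast
  let ?E = "{e. e edge_of P}"
  have finE: "finite ?E"
    using finite_polytope_faces[OF P(1)] by (rule rev_finite_subset) (auto simp: edge_of_def)
  have card_E: "6 \<le> card ?E" using card_vertices_le_card_edges[OF P(1,2)] P(3) by simp
  define K where "K = {x, y, z} \<times> {1, -1 :: real}"
  define side where "side e \<kappa> i \<longleftrightarrow> e edge_of P \<and> e = P \<inter> {p. fst \<kappa> p = real i} \<and>
    (\<forall>p\<in>P. snd \<kappa> * real i \<le> snd \<kappa> * fst \<kappa> p)" for e \<kappa> i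
  have ex_side: "\<exists>\<kappa>\<in>K. \<exists>i. side e \<kappa> i" if e: "e \<in> ?E" for e
  proof -
    obtain f i where f: "f \<in> {x, y, z}" "e \<subseteq> {p. f p = real i}"
      using net e unfolding net_segments_def by blast
    have "affine_form f" using f(1) affine by auto
    note this = edge_on_affine_form[OF poly P(2) _ this f(2)]
    then have "side e (f, 1) i \<or> side e (f, -1) i"
      using e by (auto simp: side_def)
    then show ?thesis using f(1) unfolding K_def by blast
  qed
  then obtain key where key: "\<And>e. e \<in> ?E \<Longrightarrow> key e \<in> K \<and> (\<exists>i. side e (key e) i)"
    by metis
  \<comment> \<open>Up to the sign, \<open>i\<close> is the minimum of
    \<open>snd \<kappa> * fst \<kappa>\<close> over \<open>P\<close>, so the code determines the
    line and hence the side.\<close>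
  have side_unique: "i = j" if "side e \<kappa> i" "side e' \<kappa> j" "\<kappa> \<in> K" for e e' \<kappa> i j
  proof -
    have "aff_dim e = 1" using that(1) unfolding side_def edge_of_def by blast
    then obtain p where p: "p \<in> e" by (rule aff_dim_1_two_points)
    have "aff_dim e' = 1" using that(2) unfolding side_def edge_of_def by blast
    then obtain q where q: "q \<in> e'" by (rule aff_dim_1_two_points)
    have "snd \<kappa> * real j \<le> snd \<kappa> * real i" "snd \<kappa> * real i \<le> snd \<kappa> * real j"
      using that(1,2) p q by (auto simp: side_def)
    then show ?thesis using that(3) by (auto simp: K_def)
  qed
  have "inj_on key ?E"
  proof (rule inj_onI)
    fix e e' assume e: "e \<in> ?E" "e' \<in> ?E" "key e = key e'"
    obtain i j where ij: "side e (key e) i" "side e' (key e) j" using key e by metis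
    then have "i = j" using side_unique key[OF e(1)] by blast
    then show "e = e'" using ij unfolding side_def by metis
  qed
  then have "6 \<le> card (key ` ?E)" using card_E by (simp add: card_image)
  moreover have "card K \<le> 6"
    by (simp add: K_def card_cartesian_product card_insert_if)
  moreover have "key ` ?E \<subseteq> K" using key by blast
  ultimately have keys: "key ` ?E = K"
    by (intro card_seteq) (auto simp: K_def)
  then have "\<forall>\<kappa>\<in>K. \<exists>i e. side e \<kappa> i" using key by (metis (no_types, lifting) imageE)
  then obtain bd where bd: "\<And>\<kappa>. \<kappa> \<in> K \<Longrightarrow> \<exists>e. side e \<kappa> (bd \<kappa>)" by metis
  let ?F = "\<lambda>\<kappa>. P \<inter> {p. fst \<kappa> p = real (bd \<kappa>)}"
  have bd_edge: "?F \<kappa> edge_of P" and bd_le: "\<And>p. p \<in> P \<Longrightarrow> snd \<kappa> * real (bd \<kappa>) \<le> snd \<kappa> * fst \<kappa> p"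
    if "\<kappa> \<in> K" for \<kappa>
    using bd[OF that] unfolding side_def by auto
  have edge_key: "\<exists>\<kappa>\<in>K. e = ?F \<kappa>" if e: "e edge_of P" for e
  proof -
    obtain i where i: "side e (key e) i" "key e \<in> K" using key e by blast
    then have "i = bd (key e)" using bd side_unique by blast
    then show ?thesis using i unfolding side_def by blast
  qed
  let ?t = "(bd (x, 1), bd (x, -1), bd (y, 1), bd (y, -1), bd (z, 1), bd (z, -1))"
  have hex_iff: "p \<in> hexagon ?t \<longleftrightarrow> (\<forall>\<kappa>\<in>K. snd \<kappa> * real (bd \<kappa>) \<le> snd \<kappa> * fst \<kappa> p)" for p
    by (auto simp: hexagon_def K_def)
  have sub: "P \<subseteq> hexagon ?t" using bd_le by (auto simp: hex_iff)
  \<comment> \<open>A segment from an interior point \<open>p\<close> of \<open>P\<close> to a point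
    \<open>q\<close> outside would cross an edge at some \<open>r\<close>. The inequality of that
    edge is strict at \<open>p\<close>, holds at \<open>q\<close> and is an equality at
    \<open>r\<close>, so \<open>r = q\<close>, although \<open>q\<close> is not in
    \<open>P\<close>.\<close>
  have "hexagon ?t \<subseteq> P"
  proof (rule ccontr)
    assume "\<not> hexagon ?t \<subseteq> P"
    then obtain q where q: "q \<in> hexagon ?t" "q \<notin> P" by blast
    have "rel_interior P \<noteq> {}"
      using P(1,2) rel_interior_eq_empty[of P] polytope_imp_convex by force
    then have "interior P \<noteq> {}" using interior_rel_interior[of P] P(2) by simp
    then obtain p where p: "p \<in> interior P" by blast
    then have "p \<in> P" using interior_subset by blast
    have "closed_segment p q \<inter> frontier P \<noteq> {}"
      using \<open>p \<in> P\<close> q by (intro connected_Int_frontier) auto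
    moreover have "frontier P = \<Union> {F. F facet_of P}"
      using rel_frontier_of_polyhedron[OF poly] rel_frontier_nonempty_interior \<open>interior P \<noteq> {}\<close>
      by metis
    ultimately obtain r e where r: "r \<in> closed_segment p q" "r \<in> e" "e edge_of P"
      using edge_of_eq_facet_of[OF P(2)] by blast
    obtain f s where fs: "(f, s) \<in> K" "e = ?F (f, s)" using edge_key[OF r(3)] by (metis prod.collapse)
    have "e \<noteq> P" using r(3) P(2) by (auto simp: edge_of_def)
    then have "p \<notin> e"
      using face_of_disjoint_interior[of e P] r(3) p by (auto simp: edge_of_def)
    then have less: "s * real (bd (f, s)) < s * f p"
      using bd_le[OF fs(1) \<open>p \<in> P\<close>] fs \<open>p \<in> P\<close> by (auto simp: K_def)
    obtain u where u: "0 \<le> u" "u \<le> 1" "r = (1 - u) *\<^sub>R p + u *\<^sub>R q"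
      using r(1) by (auto simp: closed_segment_def)
    have "affine_form f" using fs(1) affine by (auto simp: K_def)
    then have "f r = (1 - u) * f p + u * f q" unfolding u(3) by (rule affine_form_combination)
    moreover have "f r = real (bd (f, s))" using r(2) fs(2) by auto
    ultimately have "s * real (bd (f, s)) = s * ((1 - u) * f p + u * f q)" by simp
    then have "s * real (bd (f, s)) = (1 - u) * (s * f p) + u * (s * f q)"
      by (simp add: algebra_simps)
    moreover have "s * real (bd (f, s)) \<le> s * f q" using q(1) fs(1) unfolding hex_iff by fastforce
    moreover have "u \<noteq> 1" using u(3) r(2) q(2) fs(2) by auto
    ultimately show False
      using less u(1,2) mult_strict_left_mono[OF less, of "1 - u"]
        mult_left_mono[of "s * real (bd (f, s))" "s * f q" u]
      by (auto simp: algebra_simps)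
  qed
  with sub have eq: "P = hexagon ?t" by blast
  have box: "real (bd (x, 1)) \<le> x p" "x p \<le> real (bd (x, -1))" "real (bd (y, 1)) \<le> y p"
    "y p \<le> real (bd (y, -1))" "real (bd (z, 1)) \<le> z p" "z p \<le> real (bd (z, -1))" if "p \<in> P" for p
    using that unfolding eq by (auto simp: hexagon_def)
  have dim: "aff_dim (?F \<kappa>) = 1" if "\<kappa> \<in> K" for \<kappa>
    using bd_edge[OF that] by (simp add: edge_of_def)
  have sums: "y p + z p + x p = real n" "z p + x p + y p = real n" for p
    using sum_eq[of p] by simp_all
  have eqs: "y p = y q \<Longrightarrow> z p = z q \<Longrightarrow> p = q" "z p = z q \<Longrightarrow> x p = x q \<Longrightarrow> p = q" for p q
    using sum_eq[of p] sum_eq[of q] eq_point[of p q] by auto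
  \<comment> \<open>One application per side: sides on lower bounds supply the inequalities
    \<open>n < ...\<close>, sides on upper bounds those of the form \<open>... < n\<close>.\<close>
  have "?t \<in> hexagon_bounds n"
    using edge_coordinate_bounds[OF dim[of "(x, 1)"], of x "bd (x, 1)" "bd (y, 1)" y "bd (y, -1)"
        "bd (z, 1)" z "bd (z, -1)"]
      edge_coordinate_bounds[OF dim[of "(x, -1)"], of x "bd (x, -1)" "bd (y, 1)" y "bd (y, -1)"
        "bd (z, 1)" z "bd (z, -1)"]
      edge_coordinate_bounds[OF dim[of "(y, 1)"], of y "bd (y, 1)" "bd (z, 1)" z "bd (z, -1)"
        "bd (x, 1)" x "bd (x, -1)"]
      edge_coordinate_bounds[OF dim[of "(y, -1)"], of y "bd (y, -1)" "bd (z, 1)" z "bd (z, -1)"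
        "bd (x, 1)" x "bd (x, -1)"]
      edge_coordinate_bounds[OF dim[of "(z, 1)"], of z "bd (z, 1)" "bd (x, 1)" x "bd (x, -1)"
        "bd (y, 1)" y "bd (y, -1)"]
      edge_coordinate_bounds[OF dim[of "(z, -1)"], of z "bd (z, -1)" "bd (x, 1)" x "bd (x, -1)"
        "bd (y, 1)" y "bd (y, -1)"]
    using box sum_eq sums eq_point eqs
    by (simp add: K_def hexagon_bounds_def add.commute add.left_commute)
  then show ?thesis using eq by blast
qed

lemma bij_betw_hexagon:
  "bij_betw hexagon (hexagon_bounds n)
     {P. convex_hexagon P \<and> (\<forall>e. e edge_of P \<longrightarrow> (\<exists>s\<in>net_segments. e \<subseteq> s))}"
proof -
  have "hexagon ` hexagon_bounds n =
      {P. convex_hexagon P \<and> (\<forall>e. e edge_of P \<longrightarrow> (\<exists>s\<in>net_segments. e \<subseteq> s))}"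
  proof (intro subset_antisym subsetI)
    fix P assume "P \<in> hexagon ` hexagon_bounds n"
    then obtain a a' b b' c c' where "(a, a', b, b', c, c') \<in> hexagon_bounds n"
      "P = hexagon (a, a', b, b', c, c')" by auto
    then show "P \<in> {P. convex_hexagon P \<and> (\<forall>e. e edge_of P \<longrightarrow> (\<exists>s\<in>net_segments. e \<subseteq> s))}"
      using polytope_hexagon aff_dim_hexagon card_vertices_hexagon edge_of_hexagon
      by (simp add: convex_hexagon_def)
  qed (use net_hexagon_imp_hexagon in simp)
  then show ?thesis using inj_on_hexagon by (simp add: bij_betw_def)
qed

lemma net_segment_eq_closed_segment:
  assumes j: "j < real n" and P: "x P = j" "z P = 0" and Q: "x Q = j" "y Q = 0"
  shows "closed_segment P Q = {p. x p = j \<and> 0 \<le> y p \<and> 0 \<le> z p}"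
proof (intro subset_antisym subsetI)
  have yP: "y P = n - j" "z Q = n - j" using sum_eq[of P] sum_eq[of Q] P Q by auto
  {
    fix p assume "p \<in> closed_segment P Q"
    then obtain u where u: "0 \<le> u" "u \<le> 1" "p = (1 - u) *\<^sub>R P + u *\<^sub>R Q"
      by (auto simp: closed_segment_def)
    have "0 \<le> (1 - u) * (n - j)" "0 \<le> u * (n - j)" using u j by auto
    then show "p \<in> {p. x p = j \<and> 0 \<le> y p \<and> 0 \<le> z p}"
      unfolding u(3) by (simp add: affine_form_combination affine P Q yP) (simp add: algebra_simps)
  next
    fix p assume p: "p \<in> {p. x p = j \<and> 0 \<le> y p \<and> 0 \<le> z p}"
    \<comment> \<open>Along the segment \<open>z\<close> grows linearly from 0 at \<open>P\<close>
      to \<open>n - j\<close> at \<open>Q\<close>, and \<open>j < n\<close> keeps the quotient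
      meaningful.\<close>
    define u where "u = z p / (n - j)"
    have z: "z p \<le> n - j" using p sum_eq[of p] by auto
    have "p = (1 - u) *\<^sub>R P + u *\<^sub>R Q"
    proof (rule eq_point)
      show "x p = x ((1 - u) *\<^sub>R P + u *\<^sub>R Q)"
        using p by (simp add: affine_form_combination affine P Q) (simp add: algebra_simps)
      have "u * (n - j) = z p" using j by (simp add: u_def)
      then show "y p = y ((1 - u) *\<^sub>R P + u *\<^sub>R Q)"
        using p sum_eq[of p]
        by (simp add: affine_form_combination affine Q yP) (simp add: algebra_simps)
    qed
    moreover have "0 \<le> u" "u \<le> 1" using p z j by (auto simp: u_def)
    ultimately show "p \<in> closed_segment P Q" by (auto simp: closed_segment_def)
  }
qed

end

section \<open>Barycentric coordinates of the triangle\<close>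

text \<open>The signed area of the parallelogram spanned by \<open>u\<close> and
  \<open>v\<close>.\<close>

definition cross2 :: "real^2 \<Rightarrow> real^2 \<Rightarrow> real" where
  "cross2 u v = u$1 * v$2 - u$2 * v$1"

text \<open>The barycentric coordinate of \<open>p\<close> with respect to \<open>A\<close>, scaled to be \<open>n\<close> at \<open>A\<close>.\<close>

definition bary :: "nat \<Rightarrow> real^2 \<Rightarrow> real^2 \<Rightarrow> real^2 \<Rightarrow> real^2 \<Rightarrow> real" where
  "bary n A B C p = real n * cross2 (p - B) (C - B) / cross2 (A - B) (C - B)"

text \<open>If it vanished, \<open>A - B\<close> and \<open>C - B\<close> would both be orthogonal
  to \<open>A - B\<close> turned by a right angle, hence parallel.\<close>

lemma cross2_nonzero:
  assumes "\<not> collinear {A, B, C}"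
  shows "cross2 (A - B) (C - B) \<noteq> 0"
proof
  assume 0: "cross2 (A - B) (C - B) = 0"
  have "A \<noteq> B" using assms by auto
  let ?w = "vector [- (A - B)$2, (A - B)$1] :: real^2"
  have "?w \<noteq> 0" using \<open>A \<noteq> B\<close> by (auto simp: vec_eq_iff forall_2)
  moreover have "(A - B) \<bullet> ?w = 0" "(C - B) \<bullet> ?w = 0"
    using 0 by (simp_all add: cross2_def inner_vec_def sum_2 algebra_simps)
  ultimately obtain t where "C - B = t *\<^sub>R (A - B)"
    using parallel_of_common_normal[of ?w "A - B" "C - B"] \<open>A \<noteq> B\<close> by auto
  then show False using assms by (auto simp: collinear_3[of A B C] collinear_lemma)
qed

lemma affine_form_bary:
  assumes "n \<ge> 1" "\<not> collinear {A, B, C}"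
  shows "affine_form (bary n A B C)"
  unfolding affine_form_def
proof (intro exI conjI allI)
  let ?D = "cross2 (A - B) (C - B)"
  let ?a = "(real n / ?D) *\<^sub>R (vector [(C - B)$2, - (C - B)$1] :: real^2)"
  have D: "?D \<noteq> 0" by (rule cross2_nonzero[OF assms(2)])
  show form: "bary n A B C p = ?a \<bullet> p + - (?a \<bullet> B)" for p
    using D by (simp add: bary_def cross2_def inner_vec_def sum_2 divide_simps)
      (simp add: algebra_simps)
  have "bary n A B C A \<noteq> bary n A B C B"
    using assms(1) D by (simp add: bary_def) (simp add: cross2_def)
  then show "?a \<noteq> 0" unfolding form by auto
qed

lemma bary_vertices:
  assumes "\<not> collinear {A, B, C}"
  shows "bary n A B C A = n" "bary n A B C B = 0" "bary n A B C C = 0"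
  using cross2_nonzero[OF assms] by (simp_all add: bary_def) (simp_all add: cross2_def)

lemma net_coordinates_bary:
  assumes "n \<ge> 1" "\<not> collinear {A, B, C}"
  shows "net_coordinates n (bary n A B C) (bary n B C A) (bary n C A B)"
proof -
  have nc: "\<not> collinear {B, C, A}" "\<not> collinear {C, A, B}"
    using assms(2) by (simp_all add: insert_commute)
  let ?D = "cross2 (A - B) (C - B)"
  have D: "?D \<noteq> 0" by (rule cross2_nonzero[OF assms(2)])
  have D': "cross2 (B - C) (A - C) = ?D" "cross2 (C - A) (B - A) = ?D"
    by (simp_all add: cross2_def algebra_simps)
  \<comment> \<open>Each point is the mean of the vertices weighted by its coordinates; hence the
    coordinates determine the point.\<close>
  have repr: "real n *\<^sub>R p = bary n A B C p *\<^sub>R A + bary n B C A p *\<^sub>R B + bary n C A B p *\<^sub>R C" for p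
  proof -
    have "?D *\<^sub>R p = cross2 (p - B) (C - B) *\<^sub>R A + cross2 (p - C) (A - C) *\<^sub>R B +
        cross2 (p - A) (B - A) *\<^sub>R C"
      by (simp add: vec_eq_iff forall_2 cross2_def algebra_simps)
    then have "(real n / ?D) *\<^sub>R (?D *\<^sub>R p) = (real n / ?D) *\<^sub>R (cross2 (p - B) (C - B) *\<^sub>R A +
        cross2 (p - C) (A - C) *\<^sub>R B + cross2 (p - A) (B - A) *\<^sub>R C)"
      by (rule arg_cong)
    then show ?thesis using D by (simp add: bary_def D' scaleR_add_right)
  qed
  show ?thesis
  proof
    show "affine_form (bary n A B C)" "affine_form (bary n B C A)" "affine_form (bary n C A B)"
      by (rule affine_form_bary[OF assms(1)], fact)+
    show sum: "bary n A B C p + bary n B C A p + bary n C A B p = real n" for p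
    proof -
      have "cross2 (p - B) (C - B) + cross2 (p - C) (A - C) + cross2 (p - A) (B - A) = ?D"
        by (simp add: cross2_def algebra_simps)
      then have "real n * (cross2 (p - B) (C - B) + cross2 (p - C) (A - C) + cross2 (p - A) (B - A)) / ?D
          = real n" using D by simp
      then show ?thesis by (simp add: bary_def D' add_divide_distrib distrib_left)
    qed
    show "\<exists>p. bary n A B C p = s \<and> bary n B C A p = t" for s t
    proof -
      \<comment> \<open>With origin \<open>C\<close> and basis \<open>A - C\<close>,
        \<open>B - C\<close>, the first two barycentric coordinates are \<open>n * u\<close> and
        \<open>n * v\<close>.\<close>
      let ?p = "\<lambda>u v. C + u *\<^sub>R (A - C) + v *\<^sub>R (B - C)"
      have "cross2 (?p u v - B) (C - B) = u * ?D" "cross2 (?p u v - C) (A - C) = v * ?D" for u v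
        by (simp_all add: cross2_def algebra_simps)
      then have "bary n A B C (?p (s / n) (t / n)) = s" "bary n B C A (?p (s / n) (t / n)) = t"
        using D assms(1) by (simp_all add: bary_def D')
      then show ?thesis by blast
    qed
    show "p = q" if "bary n A B C p = bary n A B C q" "bary n B C A p = bary n B C A q" for p q
    proof -
      have "real n *\<^sub>R p = real n *\<^sub>R q"
        using that sum[of p] sum[of q] unfolding repr[of p] repr[of q] by simp
      then show ?thesis using assms(1) by simp
    qed
  qed
qed

text \<open>Division points are counted from \<open>A\<close>, where the coordinate is
  \<open>n\<close>, so the segment with index \<open>i\<close> lies at level \<open>n - i\<close>.
  Adding \<open>B C\<close> as index \<open>n\<close> supplies the level 0.\<close>

lemma cross_segments_eq_bary:
  assumes "n \<ge> 1" "\<not> collinear {A, B, C}"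
  shows "insert (closed_segment B C) (cross_segments n A B C) =
    {{p. bary n A B C p = real i \<and> 0 \<le> bary n B C A p \<and> 0 \<le> bary n C A B p} | i. i < n}"
proof -
  interpret net_coordinates n "bary n A B C" "bary n B C A" "bary n C A B"
    by (rule net_coordinates_bary[OF assms])
  have nc: "\<not> collinear {B, C, A}" "\<not> collinear {C, A, B}"
    using assms(2) by (simp_all add: insert_commute)
  define seg where "seg i = closed_segment (division_point n i A B) (division_point n i A C)" for i
  define S where "S i = {p. bary n A B C p = real i \<and> 0 \<le> bary n B C A p \<and> 0 \<le> bary n C A B p}"
    for i
  have div: "division_point n i P Q = (1 - i / n) *\<^sub>R P + (i / n) *\<^sub>R Q" for i P Q
    by (simp add: division_point_def algebra_simps)
  have seg: "seg i = S (n - i)" if "1 \<le> i" "i \<le> n" for i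
    unfolding seg_def S_def div
    using that bary_vertices[OF assms(2), of n] bary_vertices[OF nc(1), of n]
      bary_vertices[OF nc(2), of n]
    by (intro net_segment_eq_closed_segment; simp only: affine_form_combination affine;
        simp add: of_nat_diff field_simps)
  have "closed_segment B C = seg n" using assms(1) by (simp add: seg_def division_point_def)
  moreover have "cross_segments n A B C = seg ` {1..<n}"
    by (auto simp: cross_segments_def seg_def)
  moreover have "insert n {1..<n} = {1..n}" using assms(1) by auto
  ultimately have "insert (closed_segment B C) (cross_segments n A B C) = seg ` {1..n}"
    by (metis image_insert)
  also have "\<dots> = (\<lambda>i. S (n - i)) ` {1..n}"
    by (rule image_cong) (auto simp: seg)
  also have "\<dots> = S ` ((\<lambda>i. n - i) ` {1..n})" by (simp add: image_image)
  also have "(\<lambda>i. n - i) ` {1..n} = {..<n}"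
    by (auto simp: image_iff) (metis atLeastAtMost_iff diff_diff_cancel diff_le_self less_imp_le_nat
        One_nat_def Suc_leI zero_less_diff)
  finally show ?thesis by (auto simp: S_def)
qed

theorem theorem3p1:
  fixes n :: nat and A B C :: "real^2"
  assumes "n \<ge> 1" and "\<not> collinear {A, B, C}"
  shows "finite (net_hexagons n A B C) \<and>
    (\<forall>k::nat. n = 2 * k + 1 \<longrightarrow>
       real (card (net_hexagons n A B C)) =
         1 / 60 * (8 * real k ^ 6 + 24 * real k ^ 5 + 25 * real k ^ 4
                   + 10 * real k ^ 3 - 3 * real k ^ 2 - 4 * real k)) \<and>
    (\<forall>k::nat. k \<ge> 1 \<and> n = 2 * k \<longrightarrow>
       real (card (net_hexagons n A B C)) =
         1 / 60 * (8 * real k ^ 6 - 5 * real k ^ 4 - 3 * real k ^ 2))"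
proof -
  interpret net_coordinates n "bary n A B C" "bary n B C A" "bary n C A B"
    by (rule net_coordinates_bary[OF assms])
  have nc: "\<not> collinear {B, C, A}" "\<not> collinear {C, A, B}"
    using assms(2) by (simp_all add: insert_commute)
  \<comment> \<open>Each side is grouped with the cross segments parallel to it.\<close>
  have "triangular_net n A B C = insert (closed_segment B C) (cross_segments n A B C) \<union>
      insert (closed_segment C A) (cross_segments n B C A) \<union>
      insert (closed_segment A B) (cross_segments n C A B)"
    by (auto simp: triangular_net_def)
  also have "\<dots> = net_segments"
    using cross_segments_eq_bary[OF assms] cross_segments_eq_bary[OF assms(1) nc(1)]
      cross_segments_eq_bary[OF assms(1) nc(2)]
    by (simp only: net_segments_def)
  finally have bij: "bij_betw hexagon (hexagon_bounds n) (net_hexagons n A B C)"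
    using bij_betw_hexagon by (simp add: net_hexagons_def)
  have "finite (net_hexagons n A B C)"
    using bij_betw_finite[OF bij] card_hexagon_bounds(1) by blast
  then show ?thesis
    using bij_betw_same_card[OF bij] card_hexagon_bounds_odd card_hexagon_bounds_even by metis
qed

end
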